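(* Among all triangles $\Delta ABC$ which enclose a regular hexagon with sides of length $1$, the triangle of minimum area is an equilateral triangle with sides of length $3$, and its area is $(ABC) = \dfrac{9\sqrt{3}}{4}$.
   Context: A triangle $\Delta ABC$ encloses the hexagon if the (filled) hexagon is contained in the (filled) triangle, with a side of the hexagon lying on the side $AB$ of the triangle (the base), and the angles of the triangle at $A$ and $B$ are not obtuse. $(ABC)$ denotes the area of $\Delta ABC$. *)

theory Defs
  imports "HOL-Analysis.Analysis"
begin

text \<open>The undirected angle \<open>\<angle>XYZ\<close> at \<open>Y\<close>, with values in \<open>[0, pi]\<close>.
  Junk value \<open>pi/2\<close> if \<open>X = Y\<close> or \<open>Z = Y\<close>.\<close>

definition angle :: "real^2 \<Rightarrow> real^2 \<Rightarrow> real^2 \<Rightarrow> real" where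
  "angle X Y Z = arccos (((X - Y) \<bullet> (Z - Y)) / (norm (X - Y) * norm (Z - Y)))"

text \<open>A polygon is given by its vertices \<open>P 0, \<dots>, P (n - 1)\<close> in cyclic order; values \<open>P i\<close>
  with \<open>i \<ge> n\<close> are irrelevant. The filled polygon is the convex hull of the vertices, which is
  only meaningful for convex polygons.\<close>

definition polygon_side :: "nat \<Rightarrow> (nat \<Rightarrow> real^2) \<Rightarrow> nat \<Rightarrow> (real^2) set" where
  "polygon_side n P i = closed_segment (P i) (P (Suc i mod n))"

definition filled_polygon :: "nat \<Rightarrow> (nat \<Rightarrow> real^2) \<Rightarrow> (real^2) set" where
  "filled_polygon n P = convex hull (P ` {..<n})"

text \<open>Since every side is a face of the hull, its end points are extreme points, so straight
  angles are excluded; injectivity excludes running several times around a polygon with fewer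
  vertices.\<close>

definition convex_polygon :: "nat \<Rightarrow> (nat \<Rightarrow> real^2) \<Rightarrow> bool" where
  "convex_polygon n P \<longleftrightarrow> 3 \<le> n \<and> inj_on P {..<n} \<and>
     (\<forall>i<n. polygon_side n P i edge_of filled_polygon n P)"

text \<open>By convexity, the undirected angle at a vertex is the interior angle.\<close>

definition regular_polygon :: "nat \<Rightarrow> real \<Rightarrow> (nat \<Rightarrow> real^2) \<Rightarrow> bool" where
  "regular_polygon n s P \<longleftrightarrow> convex_polygon n P \<and>
     (\<forall>i<n. dist (P i) (P (Suc i mod n)) = s) \<and>
     (\<exists>\<alpha>. \<forall>i<n. angle (P i) (P (Suc i mod n)) (P (Suc (Suc i) mod n)) = \<alpha>)"

definition filled_triangle :: "real^2 \<Rightarrow> real^2 \<Rightarrow> real^2 \<Rightarrow> (real^2) set" where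
  "filled_triangle A B C = convex hull {A, B, C}"

definition triangle_area :: "real^2 \<Rightarrow> real^2 \<Rightarrow> real^2 \<Rightarrow> real" where
  "triangle_area A B C = measure lebesgue (filled_triangle A B C)"

definition encloses_hexagon ::
    "real^2 \<Rightarrow> real^2 \<Rightarrow> real^2 \<Rightarrow> (nat \<Rightarrow> real^2) \<Rightarrow> bool" where
  "encloses_hexagon A B C P \<longleftrightarrow>
     \<not> collinear {A, B, C} \<and>
     filled_polygon 6 P \<subseteq> filled_triangle A B C \<and>
     (\<exists>i<6. polygon_side 6 P i \<subseteq> closed_segment A B) \<and>
     angle C A B \<le> pi / 2 \<and> angle A B C \<le> pi / 2"

end

theory Submission
  imports Defs
begin

text \<open>
  The area bound compares horizontal chords. Put the side of the hexagon that lies on \<open>AB\<close> on the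
  first axis, so that the hexagon has a chord of length \<open>2\<close> at height \<open>r = sqrt 3 / 2\<close> and one of
  length \<open>1\<close> at height \<open>2 * r\<close>. A triangle with base \<open>w\<close> and height \<open>h\<close> has chords of length
  \<open>w - u\<close> and \<open>w - 2 * u\<close> at these heights, where \<open>u = w * r / h\<close>. Hence \<open>w - u \<ge> 2\<close> and
  \<open>w - 2 * u \<ge> 1\<close>, which give \<open>w\<^sup>2 \<ge> 6 * w - 9 \<ge> 9 * u\<close>; dividing by \<open>u\<close>, this says that twice the
  area, \<open>w * h = w\<^sup>2 * r / u\<close>, is at least \<open>9 * r\<close>. Equality forces \<open>w = 3\<close> and \<open>h = 3 * r\<close>; then
  both chords of the triangle coincide with those of the hexagon, which fixes the two remaining sides
  (\<open>enclosing_triangle_dimensions\<close>). The equilateral triangle determined in this way does enclose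
  the hexagon (\<open>encloses_hexagon_equilateral\<close>), so the bound is attained.

  What remains is to find the vertices of a regular hexagon from its definition by equal sides and
  equal undirected angles. Because every side is a face of the hull, no vertices lie strictly on
  opposite sides of its line (\<open>face_segment_same_side\<close>); so the path along the boundary always
  turns in the same direction and, by the equality of the angles, always by the same amount.
  Consecutive side vectors thus satisfy a linear recurrence, and since the path closes up after six
  steps, without meeting a vertex twice, the turn is by \<open>pi / 3\<close> (\<open>regular_hexagon_sides\<close>).
\<close>

section \<open>Lines through faces in the plane\<close>

text \<open>The signed area of the parallelogram spanned by \<open>u\<close> and \<open>v\<close>: its sign tells on which side of
  the line in direction \<open>u\<close> the vector \<open>v\<close> points.\<close>

definition det2 :: "real^2 \<Rightarrow> real^2 \<Rightarrow> real" where
  "det2 u v = u$1 * v$2 - u$2 * v$1"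

lemma inner_real2: "(u::real^2) \<bullet> v = u$1 * v$1 + u$2 * v$2"
  by (simp add: inner_vec_def sum_2)

text \<open>By Lagrange's identity, a vector with no component along \<open>u\<close> and none across it vanishes.\<close>

lemma eq_0_if_inner_det2_eq_0:
  fixes u v :: "real^2"
  assumes "u \<bullet> v = 0" "det2 u v = 0" "u \<noteq> 0"
  shows "v = 0"
proof -
  have "(u \<bullet> u) * (v \<bullet> v) = (u \<bullet> v)\<^sup>2 + (det2 u v)\<^sup>2"
    unfolding inner_real2 det2_def by algebra
  with assms show ?thesis by simp
qed

lemma multiple_if_det2_eq_0:
  fixes u v :: "real^2"
  assumes "det2 u v = 0" "u \<noteq> 0"
  obtains t where "v = t *\<^sub>R u"
proof
  define t where "t = (u \<bullet> v) / (u \<bullet> u)"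
  have "v - t *\<^sub>R u = 0"
  proof (rule eq_0_if_inner_det2_eq_0)
    show "u \<bullet> (v - t *\<^sub>R u) = 0" using assms(2) by (simp add: inner_diff_right t_def)
    show "det2 u (v - t *\<^sub>R u) = 0" using assms(1) by (simp add: det2_def algebra_simps)
  qed fact
  then show "v = t *\<^sub>R u" by simp
qed

text \<open>If \<open>X\<close> and \<open>Y\<close> were strictly separated by the line through \<open>a\<close> and \<open>b\<close>, the segment between
them would cross this line at a point of \<open>S\<close>, hence at a point of the face; a face that contains
an inner point of a segment contains its end points, which would then lie on the line.\<close>

lemma face_segment_same_side:
  fixes S :: "(real^2) set"
  assumes S: "convex S" and face: "closed_segment a b face_of S" and "a \<noteq> b"
    and X: "X \<in> S" and Y: "Y \<in> S"
  shows "0 \<le> det2 (b - a) (X - a) * det2 (b - a) (Y - a)"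
proof (rule ccontr)
  define x y where "x = det2 (b - a) (X - a)" and "y = det2 (b - a) (Y - a)"
  assume "\<not> ?thesis"
  then have neg: "x * y < 0" by (simp add: x_def y_def)
  define u where "u = x / (x - y)"
  have "x - y \<noteq> 0" using neg by (auto simp: mult_less_0_iff)
  then have u: "(1 - u) * x + u * y = 0" by (simp add: u_def field_simps)
  have u01: "0 < u" "u < 1"
    using neg unfolding u_def by (auto simp: mult_less_0_iff field_simps)
  define Z where "Z = (1 - u) *\<^sub>R X + u *\<^sub>R Y"
  have "det2 (b - a) (Z - a) = (1 - u) * x + u * y"
    unfolding Z_def x_def y_def det2_def by (simp add: algebra_simps)
  then have dZ: "det2 (b - a) (Z - a) = 0" using u by simp
  then obtain t where "Z - a = t *\<^sub>R (b - a)"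
    using multiple_if_det2_eq_0[of "b - a" "Z - a"] \<open>a \<noteq> b\<close> by auto
  then have "Z = (1 - t) *\<^sub>R a + t *\<^sub>R b" by (simp add: algebra_simps)
  then have "Z \<in> affine hull {a, b}"
    unfolding affine_hull_2 by (metis (mono_tags, lifting) diff_add_cancel mem_Collect_eq)
  moreover have "Z \<in> S" unfolding Z_def
    using convexD_alt[OF S X Y] u01 by simp
  moreover have "closed_segment a b = affine hull (closed_segment a b) \<inter> S"
    using face_of_imp_eq_affine_Int[OF S face] .
  ultimately have ZT: "Z \<in> closed_segment a b"
    using affine_hull_convex_hull[of "{a,b}"] by (simp add: segment_convex_hull)
  have "X \<noteq> Y" using neg by (auto simp: x_def y_def mult_less_0_iff)
  then have "Z \<in> open_segment X Y"
    unfolding in_segment(2) Z_def using u01 by auto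
  then have "X \<in> closed_segment a b"
    using face X Y ZT unfolding face_of_def by blast
  then obtain q where "X = (1 - q) *\<^sub>R a + q *\<^sub>R b"
    unfolding in_segment(1) by blast
  then have "X - a = q *\<^sub>R (b - a)" by (simp add: algebra_simps)
  then have "x = 0" unfolding x_def by (simp add: det2_def)
  with neg show False by simp
qed

section \<open>The side vectors of a regular hexagon\<close>

text \<open>Rotating \<open>v\<close> forwards and backwards by the same angle gives two vectors whose components
orthogonal to \<open>v\<close> cancel. The component of each along \<open>v\<close> is the cosine \<open>s\<close> of the angle.\<close>

lemma equal_turns_recurrence:
  fixes u v w :: "real^2"
  assumes "norm v = 1" "u \<bullet> v = s" "v \<bullet> w = s" "det2 u v = det2 v w"
  shows "u + w = (2 * s) *\<^sub>R v"
proof -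
  have "v \<bullet> v = 1" using assms by (simp add: dot_square_norm)
  have "u + w - (2 * s) *\<^sub>R v = 0"
  proof (rule eq_0_if_inner_det2_eq_0)
    show "v \<bullet> (u + w - (2 * s) *\<^sub>R v) = 0"
      using assms \<open>v \<bullet> v = 1\<close> by (simp add: algebra_simps inner_commute)
    show "det2 v (u + w - (2 * s) *\<^sub>R v) = 0"
      using assms(4) by (simp add: det2_def algebra_simps)
    show "v \<noteq> 0" using assms by auto
  qed
  then show ?thesis by simp
qed

text \<open>The cosine determines the sine of the turn up to its sign, and the last hypothesis says that the
two turns do not go in opposite directions.\<close>

lemma equal_turns_det2:
  fixes u v w :: "real^2"
  assumes "norm u = 1" "norm v = 1" "norm w = 1" "u \<bullet> v = s" "v \<bullet> w = s"
    and "0 \<le> det2 u v * det2 v w"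
  shows "det2 u v = det2 v w"
proof -
  have L: "(det2 p q)\<^sup>2 = (p \<bullet> p) * (q \<bullet> q) - (p \<bullet> q)\<^sup>2" for p q
    unfolding inner_real2 det2_def by algebra
  have "(det2 u v)\<^sup>2 = (det2 v w)\<^sup>2"
    unfolding L using assms by (simp add: dot_square_norm)
  then show ?thesis using assms(6) by (auto simp: power2_eq_iff mult_le_0_iff)
qed

text \<open>Let \<open>s\<close> be the cosine of the turn at each vertex. Adding up the recurrence
\<open>d j + d (j + 2) = (2 * s) *\<^sub>R d (j + 1)\<close> over the closed path shows that \<open>d 4 = - d 1\<close> unless
\<open>s = - 1/2\<close>, the case of an equilateral triangle run through twice; and \<open>d 4 = - d 1\<close> leaves only
\<open>s = 1/2\<close> unless \<open>d 3 = - d 2\<close>, that is, unless the path goes straight back. Injectivity of the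
vertices excludes both degenerate cases.\<close>

lemma regular_hexagon_sides:
  fixes P :: "nat \<Rightarrow> real^2"
  assumes "regular_polygon 6 1 P"
  defines "d \<equiv> \<lambda>j. P (Suc j mod 6) - P (j mod 6)"
  shows "norm (d j) = 1" "d j \<bullet> d (Suc j) = 1 / 2" "d (Suc (Suc j)) = d (Suc j) - d j"
proof -
  have conv: "inj_on P {..<6}" "\<And>i. i < 6 \<Longrightarrow> polygon_side 6 P i edge_of filled_polygon 6 P"
    using assms(1) by (auto simp: regular_polygon_def convex_polygon_def)
  obtain \<alpha> where \<alpha>: "\<And>i. i < 6 \<Longrightarrow> angle (P i) (P (Suc i mod 6)) (P (Suc (Suc i) mod 6)) = \<alpha>"
    using assms(1) by (auto simp: regular_polygon_def)
  have norm_d: "norm (d j) = 1" for j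
  proof -
    have "dist (P (j mod 6)) (P (Suc (j mod 6) mod 6)) = 1"
      using assms(1) by (simp add: regular_polygon_def)
    then show ?thesis by (simp add: d_def dist_norm norm_minus_commute mod_Suc_eq)
  qed
  show "norm (d j) = 1" by (fact norm_d)
  \<comment> \<open>The angle of the polygon is the one between \<open>- d j\<close> and \<open>d (j + 1)\<close>, hence the minus sign.\<close>
  have ang: "arccos (- (d j \<bullet> d (Suc j))) = \<alpha>" for j
  proof -
    have "\<alpha> = angle (P (j mod 6)) (P (Suc j mod 6)) (P (Suc (Suc j) mod 6))"
      using \<alpha>[of "j mod 6"] by (simp add: mod_Suc_eq mod_Suc_Suc_eq)
    also have "\<dots> = arccos (- (d j \<bullet> d (Suc j)) / (norm (d j) * norm (d (Suc j))))"
    proof -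
      have "P (j mod 6) - P (Suc j mod 6) = - d j"
        "P (Suc (Suc j) mod 6) - P (Suc j mod 6) = d (Suc j)"
        by (simp_all add: d_def)
      then show ?thesis
        unfolding angle_def by (simp only: inner_minus_left norm_minus_cancel)
    qed
    finally show ?thesis by (simp add: norm_d)
  qed
  define s where "s = d 0 \<bullet> d (Suc 0)"
  have s: "d j \<bullet> d (Suc j) = s" for j
  proof -
    have "\<bar>d k \<bullet> d (Suc k)\<bar> \<le> 1" for k
      using Cauchy_Schwarz_ineq2[of "d k" "d (Suc k)"] by (simp add: norm_d)
    then have "- (d j \<bullet> d (Suc j)) = - s"
      using ang[of j] ang[of 0] arccos_eq_iff unfolding s_def
      by (metis abs_minus_cancel)
    then show ?thesis by simp
  qed
  have rec: "d j + d (Suc (Suc j)) = (2 * s) *\<^sub>R d (Suc j)" for j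
  proof -
    let ?a = "P (Suc j mod 6)" and ?b = "P (Suc (Suc j) mod 6)"
    have "closed_segment ?a ?b face_of convex hull (P ` {..<6})"
      using conv(2)[of "Suc j mod 6"]
      by (simp add: polygon_side_def filled_polygon_def edge_of_def mod_Suc_eq)
    moreover have "?a \<noteq> ?b" using norm_d[of "Suc j"] by (auto simp: d_def)
    moreover have "P (k mod 6) \<in> convex hull (P ` {..<6})" for k
      by (rule hull_inc) auto
    ultimately have "0 \<le> det2 (?b - ?a) (P (j mod 6) - ?a)
                        * det2 (?b - ?a) (P (Suc (Suc (Suc j)) mod 6) - ?a)"
      by (intro face_segment_same_side[OF convex_convex_hull])
    moreover have "det2 (?b - ?a) (P (j mod 6) - ?a) = det2 (d j) (d (Suc j))"
      by (simp add: d_def det2_def algebra_simps)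
    moreover have "det2 (?b - ?a) (P (Suc (Suc (Suc j)) mod 6) - ?a)
        = det2 (d (Suc j)) (d (Suc (Suc j)))"
      by (simp add: d_def det2_def algebra_simps)
    ultimately have "det2 (d j) (d (Suc j)) = det2 (d (Suc j)) (d (Suc (Suc j)))"
      by (intro equal_turns_det2[OF norm_d norm_d norm_d s s]) simp
    then show ?thesis by (intro equal_turns_recurrence[OF norm_d s s])
  qed
  have r: "d 0 + d 2 = (2 * s) *\<^sub>R d 1" "d 1 + d 3 = (2 * s) *\<^sub>R d 2"
    "d 2 + d 4 = (2 * s) *\<^sub>R d 3" "d 3 + d 5 = (2 * s) *\<^sub>R d 4"
    using rec[of 0] rec[of 1] rec[of 2] rec[of 3] by (simp_all add: eval_nat_numeral)
  have sides: "d 0 = P 1 - P 0" "d 1 = P 2 - P 1" "d 2 = P 3 - P 2" "d 3 = P 4 - P 3"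
    "d 4 = P 5 - P 4" "d 5 = P 0 - P 5"
    by (simp_all add: d_def flip: numeral_2_eq_2)
  \<comment> \<open>These are the two diagonals that must not vanish.\<close>
  have diff: "P 3 - P 0 = (d 0 + d 2) + d 1" "P 4 - P 2 = d 2 + d 3"
    unfolding sides by simp_all
  have "(2 * s + 1) *\<^sub>R d 1 + (2 * s + 1) *\<^sub>R d 4 = (d 0 + d 2) + d 1 + (d 3 + d 5) + d 4"
    unfolding r by (simp add: algebra_simps)
  also have "\<dots> = 0" unfolding sides by simp
  finally have "(2 * s + 1) *\<^sub>R (d 1 + d 4) = 0" by (simp add: algebra_simps)
  moreover have "P 3 - P 0 \<noteq> 0" "P 4 - P 2 \<noteq> 0"
    using inj_onD[OF conv(1), of 3 0] inj_onD[OF conv(1), of 4 2] by auto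
  moreover have "P 3 - P 0 = (2 * s + 1) *\<^sub>R d 1"
    unfolding diff r by (simp add: algebra_simps)
  ultimately have opp: "d 1 + d 4 = 0" and "d 2 + d 3 \<noteq> 0"
    unfolding diff(2) by auto
  have "(d 1 + d 3) + (d 2 + d 4) = (2 * s) *\<^sub>R (d 2 + d 3)"
    unfolding r by (simp add: algebra_simps)
  then have "(2 * s - 1) *\<^sub>R (d 2 + d 3) = d 1 + d 4" by (simp add: algebra_simps)
  with opp \<open>d 2 + d 3 \<noteq> 0\<close> have "s = 1 / 2" by simp
  then show "d j \<bullet> d (Suc j) = 1 / 2" "d (Suc (Suc j)) = d (Suc j) - d j"
    using s[of j] rec[of j] by (simp_all add: algebra_simps)
qed

section \<open>The chord estimate\<close>

text \<open>The chord estimate in coordinates, with base from \<open>(a, 0)\<close> to \<open>(b, 0)\<close> and apex \<open>(c, h)\<close>. The numbers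
\<open>s\<^sub>i\<close>, \<open>t\<^sub>i\<close>, \<open>g\<^sub>i\<close> are the barycentric coordinates of the vertices of the hexagon off the base, for
\<open>i = 2, 3, 4, 5\<close> in the order in which they follow the two vertices on the base.
At equal heights two points have the same weight at the apex, so the length of a chord is \<open>b - a\<close>
times the difference of the weights \<open>t\<^sub>i\<close>, which lie between \<open>0\<close> and one minus the weight at the apex.\<close>

lemma enclosing_triangle_dimensions:
  fixes a b c h r g2 g3 g4 g5 s2 t2 s3 t3 s5 t5 s4 t4 :: real
  assumes "a < b" "0 < r"
    and nonneg: "0 \<le> s2" "0 \<le> t2" "0 \<le> s3" "0 \<le> t3" "0 \<le> s4" "0 \<le> t4" "0 \<le> s5" "0 \<le> t5"
    and g: "s2 + t2 + g2 = 1" "s3 + t3 + g3 = 1" "s4 + t4 + g4 = 1" "s5 + t5 + g5 = 1"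
    and "0 \<le> g2"
    and x: "s2 * a + t2 * b + g2 * c = 3/2" "s3 * a + t3 * b + g3 * c = 1"
           "s4 * a + t4 * b + g4 * c = 0" "s5 * a + t5 * b + g5 * c = - (1/2)"
    and y: "g2 * h = r" "g3 * h = 2 * r" "g4 * h = 2 * r" "g5 * h = r"
  shows "9 * r \<le> (b - a) * h"
    and "(b - a) * h = 9 * r \<Longrightarrow> a = - 1 \<and> b = 2 \<and> c = 1/2 \<and> h = 3 * r"
proof -
  have h: "0 < h" using y(1) \<open>0 < r\<close> \<open>0 \<le> g2\<close> by (metis mult_nonneg_nonpos not_le)
  define w \<gamma> where "w = b - a" and "\<gamma> = r / h"
  have gs: "g2 = \<gamma>" "g5 = \<gamma>" "g3 = 2 * \<gamma>" "g4 = 2 * \<gamma>"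
    using y h by (auto simp: \<gamma>_def field_simps)
  have w0: "0 < w" using \<open>a < b\<close> by (simp add: w_def)
  have \<gamma>: "0 < \<gamma>" "\<gamma> * h = r" using h \<open>0 < r\<close> by (auto simp: \<gamma>_def)
  have s: "s2 = 1 - \<gamma> - t2" "s5 = 1 - \<gamma> - t5" "s3 = 1 - 2 * \<gamma> - t3" "s4 = 1 - 2 * \<gamma> - t4"
    using g gs by auto
  have chord1: "(t2 - t5) * w = 2"
    using x(1,4) unfolding s gs w_def by (simp add: algebra_simps)
  have chord2: "(t3 - t4) * w = 1"
    using x(2,3) unfolding s gs w_def by (simp add: algebra_simps)
  have le1: "(t2 - t5) * w \<le> (1 - \<gamma>) * w"
    using w0 nonneg s by (intro mult_right_mono) auto
  have le2: "(t3 - t4) * w \<le> (1 - 2 * \<gamma>) * w"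
    using w0 nonneg s by (intro mult_right_mono) auto
  define u where "u = \<gamma> * w"
  have u1: "2 \<le> w - u" "1 \<le> w - 2 * u"
    using le1 le2 chord1 chord2 by (auto simp: u_def algebra_simps)
  \<comment> \<open>\<open>6 * w - 9\<close> is the tangent to \<open>w\<^sup>2\<close> at the optimum \<open>w = 3\<close>, and
    \<open>6 * w - 9 - 9 * u = 3 * ((w - u) - 2) + 3 * ((w - 2 * u) - 1)\<close>.\<close>
  have key: "9 * u \<le> w\<^sup>2"
    using u1 zero_le_power2[of "w - 3"] by (simp add: power2_diff)
  have u0: "0 < u" using w0 \<gamma> by (simp add: u_def)
  have prod: "\<gamma> * (w * h) = w * r" by (simp only: \<gamma>(2)[symmetric] mult_ac)
  have "u * (w * h) = w * (\<gamma> * (w * h))" by (simp only: u_def mult_ac)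
  also have "\<dots> = w\<^sup>2 * r" by (simp add: prod power2_eq_square)
  finally have "u * (9 * r) \<le> u * (w * h)" using key \<open>0 < r\<close> by simp
  then show "9 * r \<le> (b - a) * h" using u0 by (simp add: w_def)
  assume "(b - a) * h = 9 * r"
  then have "\<gamma> * (w * h) = 9 * \<gamma> * r" by (simp add: w_def)
  then have "w * r = 9 * \<gamma> * r" by (simp only: prod)
  then have "w = 9 * \<gamma>" using \<open>0 < r\<close> by simp
  then have "w\<^sup>2 = 9 * u" by (simp add: u_def power2_eq_square)
  then have "(w - 3)\<^sup>2 \<le> 0" using u1 by (simp add: power2_diff)
  then have w: "w = 3" by simp
  then have \<gamma>3: "\<gamma> = 1/3" using \<open>w = 9 * \<gamma>\<close> by simp
  \<comment> \<open>The chords of the triangle have exactly the lengths \<open>2\<close> and \<open>1\<close>, so the vertices of the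
    hexagon are their end points: those on the right have no weight at \<open>a\<close>.\<close>
  have "t2 = 2/3" "t3 = 1/3"
    using chord1 chord2 s nonneg w \<gamma>3 by auto
  then have "s2 = 0" "s3 = 0" using s \<gamma>3 by auto
  have "2/3 * b + 1/3 * c = 3/2" "1/3 * b + 2/3 * c = 1"
    using x(1,2) \<open>t2 = 2/3\<close> \<open>t3 = 1/3\<close> \<open>s2 = 0\<close> \<open>s3 = 0\<close> gs \<gamma>3 by auto
  then have "b = 2" "c = 1/2" by auto
  moreover have "a = - 1" using w \<open>b = 2\<close> by (simp add: w_def)
  moreover have "h = 3 * r" using \<gamma> \<gamma>3 by simp
  ultimately show "a = - 1 \<and> b = 2 \<and> c = 1/2 \<and> h = 3 * r" by simp
qed

section \<open>Coordinates in an orthonormal frame\<close>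

locale orthonormal_frame =
  fixes Q e f :: "real^2"
  assumes ee: "e \<bullet> e = 1" and ff: "f \<bullet> f = 1" and ef: "e \<bullet> f = 0"
begin

definition pt :: "real \<Rightarrow> real \<Rightarrow> real^2" where
  "pt x y = Q + x *\<^sub>R e + y *\<^sub>R f"

lemma det2_ef: "\<bar>det2 e f\<bar> = 1"
proof -
  have "(det2 e f)\<^sup>2 = (e \<bullet> e) * (f \<bullet> f) - (e \<bullet> f)\<^sup>2"
    unfolding inner_real2 det2_def by algebra
  then have "(det2 e f)\<^sup>2 = 1" by (simp add: ee ff ef)
  then show ?thesis by (simp add: abs_square_eq_1)
qed

lemma inner_pt_diff:
  "(pt x y - pt x' y') \<bullet> (pt x'' y'' - pt x' y') = (x - x') * (x'' - x') + (y - y') * (y'' - y')"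
proof -
  have "pt x y - pt x' y' = (x - x') *\<^sub>R e + (y - y') *\<^sub>R f" for x y x' y'
    by (simp add: pt_def algebra_simps)
  then show ?thesis using ef by (simp add: inner_add ee ff inner_commute)
qed

lemma dist_pt: "dist (pt x y) (pt x' y') = sqrt ((x - x')\<^sup>2 + (y - y')\<^sup>2)"
  unfolding dist_norm norm_eq_sqrt_inner inner_pt_diff by (simp add: power2_eq_square)

lemma pt_eq_iff: "pt x y = pt x' y' \<longleftrightarrow> x = x' \<and> y = y'"
  by (metis dist_eq_0_iff dist_pt real_sqrt_eq_zero_cancel_iff sum_power2_eq_zero_iff eq_iff_diff_eq_0)

lemma pt_add: "pt x y + (x' *\<^sub>R e + y' *\<^sub>R f) = pt (x + x') (y + y')"
  by (simp add: pt_def algebra_simps)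

lemma pt_combination:
  "(1 - u) *\<^sub>R pt x y + u *\<^sub>R pt x' y' = pt ((1 - u) * x + u * x') ((1 - u) * y + u * y')"
  by (simp add: pt_def algebra_simps)

lemma obtain_pt:
  obtains x y where "X = pt x y"
proof -
  define x where "x = e \<bullet> (X - Q)"
  have "e \<bullet> (X - Q - x *\<^sub>R e) = 0" by (simp add: x_def inner_diff_right ee)
  define y where "y = det2 e (X - Q - x *\<^sub>R e) / det2 e f"
  have "X - Q - x *\<^sub>R e - y *\<^sub>R f = 0"
  proof (rule eq_0_if_inner_det2_eq_0)
    show "e \<bullet> (X - Q - x *\<^sub>R e - y *\<^sub>R f) = 0"
      using \<open>e \<bullet> (X - Q - x *\<^sub>R e) = 0\<close> ef by (simp add: inner_diff_right)
    have "det2 e (X - Q - x *\<^sub>R e - y *\<^sub>R f) = det2 e (X - Q - x *\<^sub>R e) - y * det2 e f"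
      by (simp add: det2_def algebra_simps)
    also have "\<dots> = 0" unfolding y_def using det2_ef by auto
    finally show "det2 e (X - Q - x *\<^sub>R e - y *\<^sub>R f) = 0" .
    show "e \<noteq> 0" using ee by auto
  qed
  then have "X = pt x y" by (simp add: pt_def algebra_simps)
  then show ?thesis by (rule that)
qed

lemma triangle_area_pt:
  "triangle_area (pt a 0) (pt b 0) (pt c h) = \<bar>b - a\<bar> * \<bar>h\<bar> / 2"
proof -
  let ?T = "convex hull {pt a 0, pt b 0, pt c h}"
  have "?T \<in> sets lborel"
    by (simp add: borel_compact finite_imp_compact_convex_hull)
  then have "triangle_area (pt a 0) (pt b 0) (pt c h) = measure lborel ?T"
    by (simp add: triangle_area_def filled_triangle_def measure_completion)
  also have "\<dots> = \<bar>(b - a) * h * det2 e f\<bar> / 2"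
    unfolding content_triangle pt_def det2_def
    by (simp add: algebra_simps abs_minus_commute)
  finally have "triangle_area (pt a 0) (pt b 0) (pt c h) = \<bar>(b - a) * h * det2 e f\<bar> / 2" .
  then show ?thesis by (simp add: abs_mult det2_ef)
qed

lemma pt_in_triangle_iff:
  "pt x y \<in> filled_triangle (pt a 0) (pt b 0) (pt c h) \<longleftrightarrow>
     (\<exists>u v w. 0 \<le> u \<and> 0 \<le> v \<and> 0 \<le> w \<and> u + v + w = 1 \<and> u * a + v * b + w * c = x \<and> w * h = y)"
proof -
  have "u *\<^sub>R pt a 0 + v *\<^sub>R pt b 0 + w *\<^sub>R pt c h = pt (u * a + v * b + w * c) (w * h)"
    if "u + v + w = 1" for u v w
  proof -
    have "u *\<^sub>R pt a 0 + v *\<^sub>R pt b 0 + w *\<^sub>R pt c h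
        = (u + v + w) *\<^sub>R Q + (u * a + v * b + w * c) *\<^sub>R e + (w * h) *\<^sub>R f"
      by (simp add: pt_def algebra_simps)
    then show ?thesis using that by (simp add: pt_def)
  qed
  note comb = this
  show ?thesis
  proof
    assume "pt x y \<in> filled_triangle (pt a 0) (pt b 0) (pt c h)"
    then obtain u v w where "0 \<le> u" "0 \<le> v" "0 \<le> w" and 1: "u + v + w = 1"
      and "pt x y = u *\<^sub>R pt a 0 + v *\<^sub>R pt b 0 + w *\<^sub>R pt c h"
      unfolding filled_triangle_def convex_hull_3 by blast
    then show "\<exists>u v w. 0 \<le> u \<and> 0 \<le> v \<and> 0 \<le> w \<and> u + v + w = 1
        \<and> u * a + v * b + w * c = x \<and> w * h = y"
      unfolding comb[OF 1] pt_eq_iff by metis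
  next
    assume "\<exists>u v w. 0 \<le> u \<and> 0 \<le> v \<and> 0 \<le> w \<and> u + v + w = 1
        \<and> u * a + v * b + w * c = x \<and> w * h = y"
    then show "pt x y \<in> filled_triangle (pt a 0) (pt b 0) (pt c h)"
      unfolding filled_triangle_def convex_hull_3 by (smt (verit) comb mem_Collect_eq)
  qed
qed

text \<open>The second coordinate is affine along \<open>AB\<close> and vanishes at two different points, hence everywhere.\<close>

lemma line_through_unit_side:
  assumes "pt 0 0 \<in> closed_segment A B" "pt 1 0 \<in> closed_segment A B"
  obtains a b where "A = pt a 0" "B = pt b 0"
proof -
  obtain u v where u: "pt 0 0 = (1 - u) *\<^sub>R A + u *\<^sub>R B" and v: "pt 1 0 = (1 - v) *\<^sub>R A + v *\<^sub>R B"
    using assms unfolding in_segment(1) by blast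
  obtain a a' where A: "A = pt a a'" by (rule obtain_pt)
  obtain b b' where B: "B = pt b b'" by (rule obtain_pt)
  have "(1 - u) * a' + u * b' = 0" "(1 - v) * a' + v * b' = 0"
    "(1 - u) * a + u * b = 0" "(1 - v) * a + v * b = 1"
    using u v unfolding A B pt_combination pt_eq_iff by auto
  moreover have "u \<noteq> v" using calculation by auto
  ultimately have "(u - v) * (b' - a') = 0" by (simp add: algebra_simps)
  with \<open>u \<noteq> v\<close> have "b' = a'" by simp
  with \<open>(1 - u) * a' + u * b' = 0\<close> have "a' = 0" by (simp add: algebra_simps)
  with \<open>b' = a'\<close> show ?thesis using that A B by simp
qed

text \<open>The regular hexagon of side length \<open>1\<close> with the side from \<open>pt 0 0\<close> to \<open>pt 1 0\<close>, on the side of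
  this line into which \<open>f\<close> points.\<close>

definition hexagon :: "(real^2) set" where
  "hexagon = {pt 0 0, pt 1 0, pt (3/2) (sqrt 3 / 2), pt 1 (sqrt 3), pt 0 (sqrt 3),
     pt (- (1/2)) (sqrt 3 / 2)}"

lemma enclosing_triangle_area:
  assumes "a < b" and "hexagon \<subseteq> filled_triangle (pt a 0) (pt b 0) (pt c h)"
  shows "9 * sqrt 3 / 4 \<le> triangle_area (pt a 0) (pt b 0) (pt c h)"
    and "triangle_area (pt a 0) (pt b 0) (pt c h) = 9 * sqrt 3 / 4 \<Longrightarrow>
           a = - 1 \<and> b = 2 \<and> c = 1/2 \<and> h = 3 * sqrt 3 / 2"
proof -
  let ?r = "sqrt 3 / 2"
  have mem: "pt (3/2) ?r \<in> filled_triangle (pt a 0) (pt b 0) (pt c h)"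
    "pt 1 (2 * ?r) \<in> filled_triangle (pt a 0) (pt b 0) (pt c h)"
    "pt 0 (2 * ?r) \<in> filled_triangle (pt a 0) (pt b 0) (pt c h)"
    "pt (- (1/2)) ?r \<in> filled_triangle (pt a 0) (pt b 0) (pt c h)"
    using assms(2) by (auto simp: hexagon_def)
  obtain s2 t2 g2 where 2: "0 \<le> s2" "0 \<le> t2" "0 \<le> g2" "s2 + t2 + g2 = 1"
    "s2 * a + t2 * b + g2 * c = 3/2" "g2 * h = ?r"
    using mem(1) unfolding pt_in_triangle_iff by blast
  obtain s3 t3 g3 where 3: "0 \<le> s3" "0 \<le> t3" "0 \<le> g3" "s3 + t3 + g3 = 1"
    "s3 * a + t3 * b + g3 * c = 1" "g3 * h = 2 * ?r"
    using mem(2) unfolding pt_in_triangle_iff by blast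
  obtain s4 t4 g4 where 4: "0 \<le> s4" "0 \<le> t4" "0 \<le> g4" "s4 + t4 + g4 = 1"
    "s4 * a + t4 * b + g4 * c = 0" "g4 * h = 2 * ?r"
    using mem(3) unfolding pt_in_triangle_iff by blast
  obtain s5 t5 g5 where 5: "0 \<le> s5" "0 \<le> t5" "0 \<le> g5" "s5 + t5 + g5 = 1"
    "s5 * a + t5 * b + g5 * c = - (1/2)" "g5 * h = ?r"
    using mem(4) unfolding pt_in_triangle_iff by blast
  have r: "0 < ?r" by simp
  note dims = enclosing_triangle_dimensions[OF assms(1) r 2(1,2) 3(1,2) 4(1,2) 5(1,2)
      2(4) 3(4) 4(4) 5(4) 2(3) 2(5) 3(5) 4(5) 5(5) 2(6) 3(6) 4(6) 5(6)]
  have "0 < (b - a) * h" using dims(1) r by linarith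
  then have "0 < h" using assms(1) by (simp add: zero_less_mult_iff)
  then have area: "triangle_area (pt a 0) (pt b 0) (pt c h) = (b - a) * h / 2"
    using assms(1) by (simp add: triangle_area_pt)
  show "9 * sqrt 3 / 4 \<le> triangle_area (pt a 0) (pt b 0) (pt c h)"
    using dims(1) unfolding area by simp
  assume "triangle_area (pt a 0) (pt b 0) (pt c h) = 9 * sqrt 3 / 4"
  then have "(b - a) * h = 9 * ?r" unfolding area by linarith
  from dims(2)[OF this] show "a = - 1 \<and> b = 2 \<and> c = 1/2 \<and> h = 3 * sqrt 3 / 2"
    by simp
qed

lemma sides_equilateral:
  "dist (pt (- 1) 0) (pt 2 0) = 3"
  "dist (pt 2 0) (pt (1/2) (3 * sqrt 3 / 2)) = 3"
  "dist (pt (1/2) (3 * sqrt 3 / 2)) (pt (- 1) 0) = 3"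
  by (simp_all add: dist_pt power2_eq_square real_sqrt_unique)

text \<open>A side of the hexagon on \<open>AB\<close> puts \<open>A\<close> and \<open>B\<close> on the first axis; their order there does not matter,
because exchanging them changes neither the triangle nor its area.\<close>

lemma enclosing_triangle_minimal:
  assumes "hexagon \<subseteq> filled_triangle A B C" "A \<noteq> B"
    and side: "pt 0 0 \<in> closed_segment A B" "pt 1 0 \<in> closed_segment A B"
  shows "9 * sqrt 3 / 4 \<le> triangle_area A B C"
    and "triangle_area A B C = 9 * sqrt 3 / 4 \<Longrightarrow> dist A B = 3 \<and> dist B C = 3 \<and> dist C A = 3"
proof -
  obtain a b where AB: "A = pt a 0" "B = pt b 0"
    using side by (rule line_through_unit_side)
  obtain c h where C: "C = pt c h" by (rule obtain_pt)
  have "a \<noteq> b" using AB \<open>A \<noteq> B\<close> by auto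
  then have "a < b \<or> b < a" by linarith
  then have "9 * sqrt 3 / 4 \<le> triangle_area A B C \<and>
    (triangle_area A B C = 9 * sqrt 3 / 4 \<longrightarrow> dist A B = 3 \<and> dist B C = 3 \<and> dist C A = 3)"
  proof
    assume "a < b"
    note * = enclosing_triangle_area[OF this, of c h, folded AB C, OF assms(1)]
    show ?thesis
    proof (intro conjI[OF *(1)] impI)
      assume "triangle_area A B C = 9 * sqrt 3 / 4"
      from *(2)[OF this] have "a = - 1" "b = 2" "c = 1/2" "h = 3 * sqrt 3 / 2"
        by blast+
      then show "dist A B = 3 \<and> dist B C = 3 \<and> dist C A = 3"
        using sides_equilateral by (simp only: AB C simp_thms)
    qed
  next
    assume "b < a"
    have swap: "filled_triangle B A C = filled_triangle A B C"
      by (simp add: filled_triangle_def insert_commute)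
    then have area: "triangle_area B A C = triangle_area A B C"
      by (simp add: triangle_area_def)
    note * = enclosing_triangle_area[OF \<open>b < a\<close>, of c h, folded AB C, unfolded swap area, OF assms(1)]
    show ?thesis
    proof (intro conjI[OF *(1)] impI)
      assume "triangle_area A B C = 9 * sqrt 3 / 4"
      from *(2)[OF this] have "b = - 1" "a = 2" "c = 1/2" "h = 3 * sqrt 3 / 2"
        by blast+
      then show "dist A B = 3 \<and> dist B C = 3 \<and> dist C A = 3"
        using sides_equilateral by (simp only: AB C dist_commute)
    qed
  qed
  then show "9 * sqrt 3 / 4 \<le> triangle_area A B C"
    and "triangle_area A B C = 9 * sqrt 3 / 4 \<Longrightarrow> dist A B = 3 \<and> dist B C = 3 \<and> dist C A = 3"
    by blast+
qed

lemma area_equilateral: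
  "triangle_area (pt (- 1) 0) (pt 2 0) (pt (1/2) (3 * sqrt 3 / 2)) = 9 * sqrt 3 / 4"
  by (simp add: triangle_area_pt)

text \<open>The weights below come from the fact that the vertices of the hexagon divide the sides of the
triangle into three equal parts.\<close>

lemma hexagon_in_equilateral:
  "hexagon \<subseteq> filled_triangle (pt (- 1) 0) (pt 2 0) (pt (1/2) (3 * sqrt 3 / 2))"
proof -
  have I: "pt x y \<in> filled_triangle (pt (- 1) 0) (pt 2 0) (pt (1/2) (3 * sqrt 3 / 2))"
    if "0 \<le> u" "0 \<le> v" "0 \<le> w" "u + v + w = 1" "- u + 2 * v + w / 2 = x" "3 * w * sqrt 3 / 2 = y"
    for u v w x y
    unfolding pt_in_triangle_iff
    by (intro exI[of _ u] exI[of _ v] exI[of _ w]) (use that in auto)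
  show ?thesis unfolding hexagon_def
    using I[of "2/3" "1/3" 0 0 0] I[of "1/3" "2/3" 0 1 0]
      I[of 0 "2/3" "1/3" "3/2" "sqrt 3 / 2"] I[of 0 "1/3" "2/3" 1 "sqrt 3"]
      I[of "1/3" 0 "2/3" 0 "sqrt 3"] I[of "2/3" 0 "1/3" "- (1/2)" "sqrt 3 / 2"]
    by simp
qed

lemma angle_pt_le_pi_half:
  assumes "0 \<le> (x - x') * (x'' - x') + (y - y') * (y'' - y')"
  shows "angle (pt x y) (pt x' y') (pt x'' y'') \<le> pi / 2"
proof -
  let ?u = "pt x y - pt x' y'" and ?v = "pt x'' y'' - pt x' y'"
  have "0 \<le> ?u \<bullet> ?v" using assms by (simp add: inner_pt_diff)
  moreover have "?u \<bullet> ?v \<le> norm ?u * norm ?v" by (rule norm_cauchy_schwarz)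
  ultimately show ?thesis unfolding angle_def
    by (intro arccos_le_pi2 divide_nonneg_nonneg divide_le_eq_1[THEN iffD2])
       (auto simp: less_le)
qed

lemma encloses_hexagon_equilateral:
  assumes "filled_polygon 6 P = convex hull hexagon" "i < 6"
    and "P i = pt 0 0" "P (Suc i mod 6) = pt 1 0"
  shows "encloses_hexagon (pt (- 1) 0) (pt 2 0) (pt (1/2) (3 * sqrt 3 / 2)) P"
  unfolding encloses_hexagon_def
proof (intro conjI)
  let ?A = "pt (- 1) 0" and ?B = "pt 2 0" and ?C = "pt (1/2) (3 * sqrt 3 / 2)"
  show "\<not> collinear {?A, ?B, ?C}"
  proof
    assume "collinear {?A, ?B, ?C}"
    then obtain t where "?B = t *\<^sub>R ?A + (1 - t) *\<^sub>R ?C"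
      unfolding collinear_3_expand pt_eq_iff by auto
    moreover have "t *\<^sub>R ?A + (1 - t) *\<^sub>R ?C = (1 - (1 - t)) *\<^sub>R ?A + (1 - t) *\<^sub>R ?C"
      by simp
    ultimately have "pt 2 0 = pt ((1 - (1 - t)) * - 1 + (1 - t) * (1/2))
        ((1 - (1 - t)) * 0 + (1 - t) * (3 * sqrt 3 / 2))"
      unfolding pt_combination by simp
    then have "2 = 1/2 - 3/2 * t" "(1 - t) * (3 * sqrt 3 / 2) = 0"
      unfolding pt_eq_iff by auto
    then show False by simp
  qed
  show "filled_polygon 6 P \<subseteq> filled_triangle ?A ?B ?C"
    unfolding assms(1)
    by (rule hull_minimal[OF hexagon_in_equilateral]) (simp add: filled_triangle_def)
  have "pt x 0 \<in> closed_segment ?A ?B" if "- 1 \<le> x" "x \<le> 2" for x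
  proof -
    define u where "u = (x + 1) / 3"
    have "pt x 0 = (1 - u) *\<^sub>R ?A + u *\<^sub>R ?B"
      unfolding pt_combination pt_eq_iff by (simp add: u_def field_simps)
    moreover have "0 \<le> u" "u \<le> 1" using that by (auto simp: u_def)
    ultimately show ?thesis unfolding in_segment by blast
  qed
  then show "\<exists>i<6. polygon_side 6 P i \<subseteq> closed_segment ?A ?B"
    using assms(2-4) unfolding polygon_side_def
    by (intro exI[of _ i]) (simp add: closed_segment_subset)
qed (rule angle_pt_le_pi_half; simp)+

end

section \<open>Minimal enclosing triangles\<close>

text \<open>The second vector of the frame is obtained by orthonormalising the next side vector, which makes an
angle of \<open>pi / 3\<close> with the first; it points into the hexagon whatever the orientation of \<open>P\<close>, so
clockwise and anticlockwise hexagons need no separate treatment.\<close>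

lemma regular_hexagon_frame:
  fixes P :: "nat \<Rightarrow> real^2"
  assumes reg: "regular_polygon 6 1 P" and "i < 6"
  obtains e f where "orthonormal_frame e f"
    "P i = orthonormal_frame.pt (P i) e f 0 0"
    "P (Suc i mod 6) = orthonormal_frame.pt (P i) e f 1 0"
    "filled_polygon 6 P = convex hull (orthonormal_frame.hexagon (P i) e f)"
proof -
  define d where "d = (\<lambda>j. P (Suc j mod 6) - P (j mod 6))"
  note sides = regular_hexagon_sides[OF reg, folded d_def[THEN fun_cong]]
  define e f where "e = d i" and "f = (1 / sqrt 3) *\<^sub>R (2 *\<^sub>R d (Suc i) - d i)"
  have unit: "d j \<bullet> d j = 1" for j
    using sides(1)[of j] by (simp add: dot_square_norm)
  have "(2 *\<^sub>R d (Suc i) - d i) \<bullet> (2 *\<^sub>R d (Suc i) - d i) = 3"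
    using sides(2)[of i] by (simp add: inner_diff unit inner_commute)
  then have "f \<bullet> f = 1" by (simp add: f_def)
  moreover have "e \<bullet> f = 0"
    using sides(2)[of i] by (simp add: e_def f_def inner_diff_right unit)
  ultimately interpret orthonormal_frame "P i" e f
    by unfold_locales (simp_all add: e_def unit)
  have d0: "d i = 1 *\<^sub>R e + 0 *\<^sub>R f" by (simp add: e_def)
  have d1: "d (i + 1) = (1/2) *\<^sub>R e + (sqrt 3 / 2) *\<^sub>R f"
    by (simp add: e_def f_def scaleR_diff_right)
  have "d (i + 2) = d (i + 1) - d i" using sides(3)[of i] by simp
  also have "\<dots> = (1/2 - 1) *\<^sub>R e + (sqrt 3 / 2) *\<^sub>R f"
    unfolding d0 d1 by (simp only: scaleR_left_diff_distrib) simp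
  finally have d2: "d (i + 2) = (- (1/2)) *\<^sub>R e + (sqrt 3 / 2) *\<^sub>R f" by simp
  have "d (i + 3) = d (i + 2) - d (i + 1)"
    using sides(3)[of "i + 1"] by (simp add: eval_nat_numeral)
  also have "\<dots> = (- (1/2) - 1/2) *\<^sub>R e + (sqrt 3 / 2 - sqrt 3 / 2) *\<^sub>R f"
    unfolding d1 d2 by (simp only: scaleR_left_diff_distrib) simp
  finally have d3: "d (i + 3) = (- 1) *\<^sub>R e + 0 *\<^sub>R f" by simp
  have "d (i + 4) = d (i + 3) - d (i + 2)"
    using sides(3)[of "i + 2"] by (simp add: eval_nat_numeral)
  also have "\<dots> = (- 1 - - (1/2)) *\<^sub>R e + (0 - sqrt 3 / 2) *\<^sub>R f"
    unfolding d2 d3 by (simp only: scaleR_left_diff_distrib) simp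
  finally have d4: "d (i + 4) = (- (1/2)) *\<^sub>R e + (- (sqrt 3 / 2)) *\<^sub>R f" by simp
  have step: "P ((i + Suc j) mod 6) = P ((i + j) mod 6) + d (i + j)" for j
    by (simp add: d_def)
  have v0: "P ((i + 0) mod 6) = pt 0 0" using \<open>i < 6\<close> by (simp add: pt_def)
  have v1: "P ((i + 1) mod 6) = pt 1 0"
    using step[of 0] v0 d0 pt_add[of 0 0 1 0] by simp
  have v2: "P ((i + 2) mod 6) = pt (3/2) (sqrt 3 / 2)"
    using step[of 1] pt_add[of 1 0 "1/2" "sqrt 3 / 2"] unfolding v1 d1
    by (simp add: numeral_2_eq_2)
  have v3: "P ((i + 3) mod 6) = pt 1 (sqrt 3)"
    using step[of 2] pt_add[of "3/2" "sqrt 3 / 2" "- (1/2)" "sqrt 3 / 2"] unfolding v2 d2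
    by simp
  have v4: "P ((i + 4) mod 6) = pt 0 (sqrt 3)"
    using step[of 3] pt_add[of 1 "sqrt 3" "- 1" 0] unfolding v3 d3 by simp
  have v5: "P ((i + 5) mod 6) = pt (- (1/2)) (sqrt 3 / 2)"
    using step[of 4] pt_add[of 0 "sqrt 3" "- (1/2)" "- (sqrt 3 / 2)"] unfolding v4 d4 by simp
  \<comment> \<open>Starting from vertex \<open>i\<close> instead of vertex \<open>0\<close> only renumbers the vertices.\<close>
  have rotate: "(\<lambda>j. (i + j) mod 6) ` {..<6} = {..<6}"
  proof (intro subset_antisym subsetI)
    fix k :: nat assume "k \<in> {..<6}"
    then have "k = (i + (k + 6 - i) mod 6) mod 6" using \<open>i < 6\<close>
      by (simp add: mod_add_right_eq)
    then show "k \<in> (\<lambda>j. (i + j) mod 6) ` {..<6}" by (rule image_eqI) simp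
  qed auto
  have "P ` {..<6} = (\<lambda>j. P ((i + j) mod 6)) ` {..<6}"
    using rotate by (metis image_image)
  moreover have "{..<6} = {0, 1, 2, 3, 4, 5 :: nat}" by auto
  ultimately have "P ` {..<6} = (\<lambda>j. P ((i + j) mod 6)) ` {0, 1, 2, 3, 4, 5}"
    by simp
  also have "\<dots> = hexagon"
    by (simp only: image_insert image_empty v0 v1 v2 v3 v4 v5 hexagon_def)
  finally have "P ` {..<6} = hexagon" .
  then have "filled_polygon 6 P = convex hull hexagon" by (simp add: filled_polygon_def)
  moreover have "P i = pt 0 0" "P (Suc i mod 6) = pt 1 0"
    using v0 v1 \<open>i < 6\<close> by simp_all
  ultimately show ?thesis using that orthonormal_frame_axioms by blast
qed

lemma encloses_hexagon_minimal:
  assumes reg: "regular_polygon 6 1 P" and enc: "encloses_hexagon A B C P"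
  shows "9 * sqrt 3 / 4 \<le> triangle_area A B C"
    and "triangle_area A B C = 9 * sqrt 3 / 4 \<Longrightarrow> dist A B = 3 \<and> dist B C = 3 \<and> dist C A = 3"
proof -
  obtain i where i: "i < 6" "polygon_side 6 P i \<subseteq> closed_segment A B"
    using enc by (auto simp: encloses_hexagon_def)
  obtain e f where frame: "orthonormal_frame e f"
    "P i = orthonormal_frame.pt (P i) e f 0 0"
    "P (Suc i mod 6) = orthonormal_frame.pt (P i) e f 1 0"
    "filled_polygon 6 P = convex hull (orthonormal_frame.hexagon (P i) e f)"
    using regular_hexagon_frame[OF reg i(1)] .
  interpret orthonormal_frame "P i" e f by (fact frame(1))
  have "hexagon \<subseteq> filled_triangle A B C"
    using enc hull_subset[of hexagon convex] unfolding encloses_hexagon_def frame(4) by blast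
  moreover have "A \<noteq> B" using enc by (auto simp: encloses_hexagon_def)
  moreover have "pt 0 0 \<in> closed_segment A B" "pt 1 0 \<in> closed_segment A B"
    using i(2) unfolding polygon_side_def frame(3) frame(2)[symmetric] by auto
  ultimately show "9 * sqrt 3 / 4 \<le> triangle_area A B C"
    and "triangle_area A B C = 9 * sqrt 3 / 4 \<Longrightarrow> dist A B = 3 \<and> dist B C = 3 \<and> dist C A = 3"
    by (rule enclosing_triangle_minimal)+
qed

theorem theorem3:
  fixes P :: "nat \<Rightarrow> real^2"
  assumes "regular_polygon 6 1 P"
  shows "(\<exists>A B C. is_arg_min (\<lambda>(A, B, C). triangle_area A B C)
                    (\<lambda>(A, B, C). encloses_hexagon A B C P) (A, B, C)) \<and>
         (\<forall>A B C. is_arg_min (\<lambda>(A, B, C). triangle_area A B C)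
                    (\<lambda>(A, B, C). encloses_hexagon A B C P) (A, B, C) \<longrightarrow>
            dist A B = 3 \<and> dist B C = 3 \<and> dist C A = 3 \<and>
            triangle_area A B C = 9 * sqrt 3 / 4)"
proof -
  obtain e f where frame: "orthonormal_frame e f"
    "P 0 = orthonormal_frame.pt (P 0) e f 0 0"
    "P (Suc 0 mod 6) = orthonormal_frame.pt (P 0) e f 1 0"
    "filled_polygon 6 P = convex hull (orthonormal_frame.hexagon (P 0) e f)"
    using regular_hexagon_frame[OF assms, of 0] by auto
  interpret orthonormal_frame "P 0" e f by (fact frame(1))
  obtain A B C where enc: "encloses_hexagon A B C P"
    and area: "triangle_area A B C = 9 * sqrt 3 / 4"
    using encloses_hexagon_equilateral[OF frame(4) _ frame(2,3)] area_equilateral by auto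
  note minimal = encloses_hexagon_minimal[OF assms]
  have "triangle_area A B C \<le> triangle_area A' B' C'" if "encloses_hexagon A' B' C' P"
    for A' B' C'
    using minimal(1)[OF that] area by simp
  then have "is_arg_min (\<lambda>(A, B, C). triangle_area A B C)
      (\<lambda>(A, B, C). encloses_hexagon A B C P) (A, B, C)"
    unfolding is_arg_min_def using enc by (auto simp: not_less)
  moreover have "dist A' B' = 3 \<and> dist B' C' = 3 \<and> dist C' A' = 3
      \<and> triangle_area A' B' C' = 9 * sqrt 3 / 4"
    if "is_arg_min (\<lambda>(A, B, C). triangle_area A B C)
      (\<lambda>(A, B, C). encloses_hexagon A B C P) (A', B', C')" for A' B' C'
  proof -
    have enc': "encloses_hexagon A' B' C' P"
      and "\<not> triangle_area A B C < triangle_area A' B' C'"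
      using that enc unfolding is_arg_min_def by auto
    then have "triangle_area A' B' C' = 9 * sqrt 3 / 4"
      using minimal(1)[OF enc'] area by linarith
    with minimal(2)[OF enc'] show ?thesis by blast
  qed
  ultimately show ?thesis by blast
qed

end
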